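(* Let $z,w,u,v>0$ with $(z,w),(u,v)\in\mathcal E$, and let $c\in X^+_{\rho,\sigma}$. Then $$H[c|\bar c^{u,v}]=H[c|\bar c^{z,w}]+H[\bar c^{z,w}|\bar c^{u,v}]+\ln\Big(\frac zu\Big)\big(\rho-\rho(\bar c^{z,w})\big)+\ln\Big(\frac wv\Big)\big(\sigma-\sigma(\bar c^{z,w})\big).$$
   Context: $\Omega=\{(r,s)\in\mathbb N_0^2 : r+s\ge1\}$, and $Q_{r,s}>0$, $(r,s)\in\Omega$, are given positive numbers with $Q_{1,0}=Q_{0,1}=1$. For $z,w\ge0$ let $\bar c^{z,w}_{r,s}=z^rw^sQ_{r,s}$. For a nonnegative sequence $c$ on $\Omega$, $\rho(c)=\sum_{(r,s)\in\Omega}r\,c_{r,s}$ and $\sigma(c)=\sum_{(r,s)\in\Omega}s\,c_{r,s}$. The region of existence is $\mathcal E=\{(z,w): z\ge0,\ w\ge0,\ \rho(\bar c^{z,w})+\sigma(\bar c^{z,w})<\infty\}$; it is assumed to contain a pair with both entries positive. $X^+$ is the set of nonnegative sequences $c=(c_{r,s})_{(r,s)\in\Omega}$ with $\sum_{(r,s)\in\Omega}(r+s)c_{r,s}<\infty$, and $X^+_{\rho,\sigma}=\{c\in X^+: \rho(c)=\rho,\ \sigma(c)=\sigma\}$. For $z,w>0$ with $(z,w)\in\mathcal E$ and $c\in X^+$ the relative entropy is $$H[c|\bar c^{z,w}]=\sum_{(r,s)\in\Omega}\bar c^{z,w}_{r,s}\Psi\Big(\frac{c_{r,s}}{\bar c^{z,w}_{r,s}}\Big)\in[0,\infty],\qquad\Psi(x)=x\ln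 x+1-x\ge0,\quad \Psi(0)=1.$$ *)

theory Defs
  imports "HOL-Analysis.Analysis"
begin

text \<open>
  A sequence indexed by \<open>\<Omega>\<close> is a function on \<open>nat \<times> nat\<close>. Its value at \<open>(0, 0)\<close>, which lies
  outside \<open>\<Omega>\<close>, is unconstrained and never used. Series of nonnegative terms are summed in
  \<open>ennreal\<close>, where a divergent series has the value \<open>\<infinity>\<close>.
\<close>

definition Omega :: "(nat \<times> nat) set" where
  "Omega = {(r, s). r + s \<ge> 1}"

definition cbar :: "(nat \<times> nat \<Rightarrow> real) \<Rightarrow> real \<Rightarrow> real \<Rightarrow> nat \<times> nat \<Rightarrow> real" where
  "cbar Q z w = (\<lambda>(r, s). z ^ r * w ^ s * Q (r, s))"

definition rho_sum :: "(nat \<times> nat \<Rightarrow> real) \<Rightarrow> ennreal" where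
  "rho_sum c = (\<Sum>\<^sub>\<infinity>(r, s)\<in>Omega. ennreal (real r * c (r, s)))"

definition sigma_sum :: "(nat \<times> nat \<Rightarrow> real) \<Rightarrow> ennreal" where
  "sigma_sum c = (\<Sum>\<^sub>\<infinity>(r, s)\<in>Omega. ennreal (real s * c (r, s)))"

definition existence_region :: "(nat \<times> nat \<Rightarrow> real) \<Rightarrow> (real \<times> real) set" where
  "existence_region Q =
     {(z, w). z \<ge> 0 \<and> w \<ge> 0 \<and> rho_sum (cbar Q z w) + sigma_sum (cbar Q z w) < \<infinity>}"

definition X_plus :: "(nat \<times> nat \<Rightarrow> real) set" where
  "X_plus = {c. (\<forall>p\<in>Omega. c p \<ge> 0) \<and>
                (\<Sum>\<^sub>\<infinity>(r, s)\<in>Omega. ennreal (real (r + s) * c (r, s))) < \<infinity>}"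

text \<open>
  The prescribed values are compared in \<open>ereal\<close>, since \<open>ennreal x = 0\<close> for every negative \<open>x\<close>.
\<close>

definition X_plus_rs :: "real \<Rightarrow> real \<Rightarrow> (nat \<times> nat \<Rightarrow> real) set" where
  "X_plus_rs \<rho> \<sigma> =
     {c \<in> X_plus. enn2ereal (rho_sum c) = ereal \<rho> \<and> enn2ereal (sigma_sum c) = ereal \<sigma>}"

definition Psi :: "real \<Rightarrow> real" where
  "Psi x = x * ln x + 1 - x"

lemma Psi_0: "Psi 0 = 1"
  by (simp add: Psi_def)

lemma Psi_nonneg:
  assumes "x \<ge> 0"
  shows "Psi x \<ge> 0"
proof (cases "x = 0")
  case True
  then show ?thesis by (simp add: Psi_0)
next
  case False
  with assms have x: "x > 0" by simp
  then have "ln (1 / x) \<le> 1 / x - 1" by (intro ln_le_minus_one) simp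
  with x have "x * (- ln x) \<le> x * (1 / x - 1)" by (intro mult_left_mono) (simp_all add: ln_div)
  with x show ?thesis by (simp add: Psi_def algebra_simps)
qed

text \<open>
  The relative entropy \<open>H[c|d]\<close>, for nonnegative \<open>c\<close> and positive \<open>d\<close>. By \<open>Psi_nonneg\<close>, the
  coercion to \<open>ennreal\<close> does not truncate any term.
\<close>

definition rel_entropy :: "(nat \<times> nat \<Rightarrow> real) \<Rightarrow> (nat \<times> nat \<Rightarrow> real) \<Rightarrow> ennreal" where
  "rel_entropy c d = (\<Sum>\<^sub>\<infinity>p\<in>Omega. ennreal (d p * Psi (c p / d p)))"

end

theory Submission
  imports Defs
begin

text \<open>
  With \<open>a\<close> and \<open>b\<close> the equilibria at \<open>(z, w)\<close> and \<open>(u, v)\<close>, the logarithm of \<open>a / b\<close> at \<open>(r, s)\<close> is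
  \<open>r ln (z / u) + s ln (w / v)\<close>, so the identity holds term by term:
  \<open>b \<Psi>(c / b) = a \<Psi>(c / a) + b \<Psi>(a / b) + (c - a) ln (a / b)\<close>. The last two terms are summable because
  first moments are finite. Hence the two series involving \<open>c\<close> converge or diverge together.
\<close>

text \<open>For nonnegative terms both sums are the supremum of the finite partial sums. The lemma
  moves series from \<open>ennreal\<close>, where the entropies and moments are defined, to the
  reals, where series can be subtracted and signed terms occur. The single equation in
  \<open>ereal\<close> records both finiteness and the value.\<close>

lemma has_sum_iff_infsum_ennreal:
  fixes f :: "'a \<Rightarrow> real"
  assumes nonneg: "\<And>x. x \<in> A \<Longrightarrow> f x \<ge> 0"
  shows "(f has_sum S) A \<longleftrightarrow> enn2ereal (\<Sum>\<^sub>\<infinity>x\<in>A. ennreal (f x)) = ereal S"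
proof -
  have sup: "(\<Sum>\<^sub>\<infinity>x\<in>A. ennreal (f x)) = (SUP F\<in>{F. finite F \<and> F \<subseteq> A}. ennreal (sum f F))"
    using nonneg by (subst nonneg_infsum_complete) (auto intro!: SUP_cong sum_ennreal)
  have eq: "enn2ereal (\<Sum>\<^sub>\<infinity>x\<in>A. ennreal (f x)) = ereal (infsum f A)" if "f summable_on A"
  proof -
    have "(\<Sum>\<^sub>\<infinity>x\<in>A. ennreal (f x)) = ennreal (infsum f A)"
      using infsum_nonneg_is_SUPREMUM_ennreal[OF that nonneg] sup by simp
    then show ?thesis
      using infsum_nonneg[of A f] nonneg by (simp add: enn2ereal_ennreal)
  qed
  have summable: "f summable_on A" if S: "enn2ereal (\<Sum>\<^sub>\<infinity>x\<in>A. ennreal (f x)) = ereal S"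
  proof (rule nonneg_bdd_above_summable_on[OF nonneg])
    \<comment> \<open>The sign of \<open>S\<close> makes the comparison in \<open>ennreal\<close>
      below equivalent to one of reals; coercion would truncate a negative bound to 0.\<close>
    have "S \<ge> 0"
      using enn2ereal_nonneg[of "\<Sum>\<^sub>\<infinity>x\<in>A. ennreal (f x)"] S by simp
    have sum_eq: "(\<Sum>\<^sub>\<infinity>x\<in>A. ennreal (f x)) = ennreal S"
      using arg_cong[OF S, of e2ennreal] by simp
    have "sum f F \<le> S" if F: "F \<subseteq> A" "finite F" for F
    proof -
      have "ennreal (sum f F) \<le> ennreal S"
        using F by (subst sum_eq[symmetric], subst sup) (auto intro: SUP_upper)
      then show ?thesis
        using \<open>S \<ge> 0\<close> by simp
    qed
    then show "bdd_above (sum f ` {F. F \<subseteq> A \<and> finite F})"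
      by (auto simp: bdd_above_def)
  qed auto
  show ?thesis
  proof
    assume "(f has_sum S) A"
    then show "enn2ereal (\<Sum>\<^sub>\<infinity>x\<in>A. ennreal (f x)) = ereal S"
      using eq by (simp add: has_sum_imp_summable infsumI)
  next
    assume S: "enn2ereal (\<Sum>\<^sub>\<infinity>x\<in>A. ennreal (f x)) = ereal S"
    then show "(f has_sum S) A"
      using eq[OF summable[OF S]] summable[OF S] by (simp add: has_sum_iff)
  qed
qed

lemma has_sum_diff:
  fixes f g :: "'a \<Rightarrow> 'b::topological_ab_group_add"
  assumes "(f has_sum x) A" "(g has_sum y) A"
  shows "((\<lambda>p. f p - g p) has_sum (x - y)) A"
  using has_sum_add[OF assms(1), of "\<lambda>p. - g p" "- y"] assms(2) by (simp add: has_sum_uminus)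

lemma rho_sum_eq_iff:
  assumes "\<And>p. p \<in> Omega \<Longrightarrow> d p \<ge> 0"
  shows "enn2ereal (rho_sum d) = ereal x \<longleftrightarrow> ((\<lambda>p. real (fst p) * d p) has_sum x) Omega"
  using assms by (subst has_sum_iff_infsum_ennreal) (simp_all add: rho_sum_def case_prod_unfold)

lemma sigma_sum_eq_iff:
  assumes "\<And>p. p \<in> Omega \<Longrightarrow> d p \<ge> 0"
  shows "enn2ereal (sigma_sum d) = ereal x \<longleftrightarrow> ((\<lambda>p. real (snd p) * d p) has_sum x) Omega"
  using assms by (subst has_sum_iff_infsum_ennreal) (simp_all add: sigma_sum_def case_prod_unfold)

lemma rel_entropy_eq_iff:
  assumes "\<And>p. p \<in> Omega \<Longrightarrow> c p \<ge> 0" "\<And>p. p \<in> Omega \<Longrightarrow> d p > 0"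
  shows "enn2ereal (rel_entropy c d) = ereal x \<longleftrightarrow> ((\<lambda>p. d p * Psi (c p / d p)) has_sum x) Omega"
  unfolding rel_entropy_def using assms
  by (intro has_sum_iff_infsum_ennreal[symmetric] mult_nonneg_nonneg Psi_nonneg divide_nonneg_nonneg)
     (auto intro: less_imp_le)

lemma enn2ereal_eq_infinity_or_real:
  obtains "enn2ereal x = \<infinity>" | r where "enn2ereal x = ereal r"
  using enn2ereal_nonneg[of x] by (cases "enn2ereal x") auto

text \<open>Since (0, 0) is excluded, r + s is at least 1, so the two first moments together
  dominate the series itself.\<close>

lemma summable_on_Omega:
  fixes d :: "nat \<times> nat \<Rightarrow> real"
  assumes nonneg: "\<And>p. p \<in> Omega \<Longrightarrow> d p \<ge> 0"
    and "(\<lambda>p. real (fst p) * d p) summable_on Omega"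
    and "(\<lambda>p. real (snd p) * d p) summable_on Omega"
  shows "d summable_on Omega"
proof (rule summable_on_comparison_test[OF summable_on_add[OF assms(2,3)]])
  fix p :: "nat \<times> nat" assume p: "p \<in> Omega"
  then have "real (fst p) + real (snd p) \<ge> 1"
    by (auto simp: Omega_def)
  then have "1 * d p \<le> (real (fst p) + real (snd p)) * d p"
    using nonneg[OF p] by (intro mult_right_mono)
  then show "d p \<le> real (fst p) * d p + real (snd p) * d p"
    by (simp add: distrib_right)
qed (rule nonneg)

lemma cbar_pos:
  assumes "\<forall>p\<in>Omega. Q p > 0" "z > 0" "w > 0" "p \<in> Omega"
  shows "cbar Q z w p > 0"
  using assms by (auto simp: cbar_def split: prod.split)

lemma existence_region_moments:
  assumes Q: "\<forall>p\<in>Omega. Q p > 0" and zw: "z > 0" "w > 0" "(z, w) \<in> existence_region Q"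
  obtains x y where "enn2ereal (rho_sum (cbar Q z w)) = ereal x"
    "enn2ereal (sigma_sum (cbar Q z w)) = ereal y" "cbar Q z w summable_on Omega"
proof -
  have nonneg: "cbar Q z w p \<ge> 0" if "p \<in> Omega" for p
    using cbar_pos[OF Q zw(1,2) that] by simp
  have "rho_sum (cbar Q z w) < \<infinity>" "sigma_sum (cbar Q z w) < \<infinity>"
    using zw(3) by (auto simp: existence_region_def)
  then have "enn2ereal (rho_sum (cbar Q z w)) \<noteq> \<infinity>" "enn2ereal (sigma_sum (cbar Q z w)) \<noteq> \<infinity>"
    by auto
  then obtain x y where xy: "enn2ereal (rho_sum (cbar Q z w)) = ereal x"
      "enn2ereal (sigma_sum (cbar Q z w)) = ereal y"
    using enn2ereal_eq_infinity_or_real by meson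
  then have "(\<lambda>p. real (fst p) * cbar Q z w p) summable_on Omega"
      "(\<lambda>p. real (snd p) * cbar Q z w p) summable_on Omega"
    using rho_sum_eq_iff[of "cbar Q z w" x] sigma_sum_eq_iff[of "cbar Q z w" y] nonneg
    by (simp_all add: has_sum_imp_summable)
  then have "cbar Q z w summable_on Omega"
    by (rule summable_on_Omega[rotated]) (rule nonneg)
  with xy show thesis
    by (rule that)
qed

text \<open>Here \<open>b * Psi (c / b)\<close> is c ln (c / b) + b - c. Write ln (c / b) as ln (c /
  a) + ln (a / b) and b - c as (a - c) + (b - a); the part a ln (a / b) of c ln (a / b) goes into
  \<open>b * Psi (a / b)\<close>. For c = 0 the logarithm does not split, but both sides equal
  b.\<close>

lemma Psi_change_reference:
  assumes "a > 0" "b > 0" "c \<ge> 0"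
  shows "b * Psi (c / b) = a * Psi (c / a) + b * Psi (a / b) + (c - a) * ln (a / b)"
proof (cases "c = 0")
  case True
  with assms show ?thesis
    by (simp add: Psi_def field_simps)
next
  case False
  with assms show ?thesis
    by (simp add: Psi_def ln_div field_simps)
qed

text \<open>The factor \<open>Q p\<close> cancels in the quotient, which leaves only powers of z / u
  and w / v. Linearity in r and s is what turns the cross term of the entropies into first
  moments.\<close>

lemma ln_cbar_ratio:
  assumes "z > 0" "w > 0" "u > 0" "v > 0" "Q p > 0"
  shows "ln (cbar Q z w p / cbar Q u v p) = real (fst p) * ln (z / u) + real (snd p) * ln (w / v)"
  using assms by (auto simp: cbar_def ln_div ln_mult ln_realpow algebra_simps split: prod.split)

theorem lemma4p2:
  fixes Q c :: "nat \<times> nat \<Rightarrow> real" and z w u v \<rho> \<sigma> :: real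
  assumes "\<forall>p\<in>Omega. Q p > 0"
    and "Q (1, 0) = 1" and "Q (0, 1) = 1"
    and "\<exists>a b. a > 0 \<and> b > 0 \<and> (a, b) \<in> existence_region Q"
    and "z > 0" and "w > 0" and "u > 0" and "v > 0"
    and "(z, w) \<in> existence_region Q" and "(u, v) \<in> existence_region Q"
    and "c \<in> X_plus_rs \<rho> \<sigma>"
  shows "enn2ereal (rel_entropy c (cbar Q u v)) =
           enn2ereal (rel_entropy c (cbar Q z w))
         + enn2ereal (rel_entropy (cbar Q z w) (cbar Q u v))
         + ereal (ln (z / u)) * (ereal \<rho> - enn2ereal (rho_sum (cbar Q z w)))
         + ereal (ln (w / v)) * (ereal \<sigma> - enn2ereal (sigma_sum (cbar Q z w)))"
proof -
  note Q = assms(1) and zw = assms(5,6,9) and uv = assms(7,8,10)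
  let ?a = "cbar Q z w" and ?b = "cbar Q u v"
  define L M where "L = ln (z / u)" and "M = ln (w / v)"
  have pos: "?a p > 0" "?b p > 0" if "p \<in> Omega" for p
    using cbar_pos[OF Q] zw uv that by auto
  have nonneg: "?a p \<ge> 0" "c p \<ge> 0" if "p \<in> Omega" for p
    using pos[OF that] assms(11) that by (auto simp: X_plus_rs_def X_plus_def)
  have ln_ab: "ln (?a p / ?b p) = real (fst p) * L + real (snd p) * M" if "p \<in> Omega" for p
    using ln_cbar_ratio assms that by (auto simp: L_def M_def)
  obtain x y where xy: "enn2ereal (rho_sum ?a) = ereal x" "enn2ereal (sigma_sum ?a) = ereal y"
    and a: "?a summable_on Omega"
    using existence_region_moments[OF Q zw] by blast
  have b: "?b summable_on Omega"
    using existence_region_moments[OF Q uv] by blast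
  have a_mom: "((\<lambda>p. real (fst p) * ?a p) has_sum x) Omega"
    "((\<lambda>p. real (snd p) * ?a p) has_sum y) Omega"
    using xy nonneg by (simp_all add: rho_sum_eq_iff sigma_sum_eq_iff)
  have c_mom: "((\<lambda>p. real (fst p) * c p) has_sum \<rho>) Omega"
    "((\<lambda>p. real (snd p) * c p) has_sum \<sigma>) Omega"
    using assms(11) nonneg by (auto simp: X_plus_rs_def rho_sum_eq_iff sigma_sum_eq_iff)
  \<comment> \<open>\<open>E\<close> is the finite, possibly negative, sum of the cross terms (c -
    a) ln (a / b).\<close>
  define E where "E = L * (\<rho> - x) + M * (\<sigma> - y)"
  have "((\<lambda>p. L * (real (fst p) * c p - real (fst p) * ?a p)
      + M * (real (snd p) * c p - real (snd p) * ?a p)) has_sum E) Omega"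
    unfolding E_def by (intro has_sum_add has_sum_cmult_right has_sum_diff c_mom a_mom)
  also have "?this \<longleftrightarrow> ((\<lambda>p. (c p - ?a p) * ln (?a p / ?b p)) has_sum E) Omega"
    by (intro has_sum_cong) (simp add: ln_ab algebra_simps)
  finally have E: "((\<lambda>p. (c p - ?a p) * ln (?a p / ?b p)) has_sum E) Omega" .
  \<comment> \<open>The entropy of one equilibrium relative to the other is finite: its terms a ln
    (a / b) + b - a combine the first moments of a with the summable sequences a and b.\<close>
  have "(\<lambda>p. L * (real (fst p) * ?a p) + M * (real (snd p) * ?a p) + (?b p - ?a p)) summable_on Omega"
    using a_mom has_sum_diff[OF has_sum_infsum[OF b] has_sum_infsum[OF a]]
    by (intro summable_on_add summable_on_cmult_right) (auto simp: summable_on_def)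
  also have "?this \<longleftrightarrow> (\<lambda>p. ?b p * Psi (?a p / ?b p)) summable_on Omega"
  proof (rule summable_on_cong)
    fix p assume p: "p \<in> Omega"
    have "?b p * Psi (?a p / ?b p) = ?a p * ln (?a p / ?b p) + ?b p - ?a p"
      using pos[OF p] by (simp add: Psi_def field_simps)
    then show "L * (real (fst p) * ?a p) + M * (real (snd p) * ?a p) + (?b p - ?a p)
        = ?b p * Psi (?a p / ?b p)"
      by (simp add: ln_ab[OF p] algebra_simps)
  qed
  finally obtain K where K: "((\<lambda>p. ?b p * Psi (?a p / ?b p)) has_sum K) Omega"
    by (auto simp: summable_on_def)
  then have K': "enn2ereal (rel_entropy ?a ?b) = ereal K"
    using pos nonneg by (simp add: rel_entropy_eq_iff)
  have split: "?b p * Psi (c p / ?b p)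
      = ?a p * Psi (c p / ?a p) + (?b p * Psi (?a p / ?b p) + (c p - ?a p) * ln (?a p / ?b p))"
    if "p \<in> Omega" for p
    using Psi_change_reference[OF pos[OF that] nonneg(2)[OF that]] by simp
  have KE: "((\<lambda>p. ?b p * Psi (?a p / ?b p) + (c p - ?a p) * ln (?a p / ?b p)) has_sum (K + E)) Omega"
    by (intro has_sum_add K E)
  have fwd: "enn2ereal (rel_entropy c ?b) = ereal (h + (K + E))"
    if "enn2ereal (rel_entropy c ?a) = ereal h" for h
  proof -
    have "((\<lambda>p. ?a p * Psi (c p / ?a p)) has_sum h) Omega"
      using that pos nonneg by (simp add: rel_entropy_eq_iff)
    from has_sum_add[OF this KE]
    have "((\<lambda>p. ?b p * Psi (c p / ?b p)) has_sum (h + (K + E))) Omega"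
      by (simp add: split cong: has_sum_cong)
    then show ?thesis
      using pos nonneg by (simp add: rel_entropy_eq_iff)
  qed
  \<comment> \<open>The converse of \<open>fwd\<close>: the finite series \<open>KE\<close> can be
    subtracted as well as added. It excludes a finite left side when the entropy relative to a is
    infinite.\<close>
  have bwd: "enn2ereal (rel_entropy c ?a) = ereal (h - (K + E))"
    if "enn2ereal (rel_entropy c ?b) = ereal h" for h
  proof -
    have "((\<lambda>p. ?b p * Psi (c p / ?b p)) has_sum h) Omega"
      using that pos nonneg by (simp add: rel_entropy_eq_iff)
    from has_sum_diff[OF this KE]
    have "((\<lambda>p. ?a p * Psi (c p / ?a p)) has_sum (h - (K + E))) Omega"
      by (simp add: split cong: has_sum_cong)
    then show ?thesis
      using pos nonneg by (simp add: rel_entropy_eq_iff)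
  qed
  \<comment> \<open>On the right only the first summand can be infinite, and it then absorbs the
    real ones, so no undetermined form arises in \<open>ereal\<close>.\<close>
  have "enn2ereal (rel_entropy c ?b) = enn2ereal (rel_entropy c ?a) + ereal K
      + ereal L * (ereal \<rho> - ereal x) + ereal M * (ereal \<sigma> - ereal y)"
  proof (cases rule: enn2ereal_eq_infinity_or_real[of "rel_entropy c ?a"])
    case 1
    then have "enn2ereal (rel_entropy c ?b) = \<infinity>"
      by (cases rule: enn2ereal_eq_infinity_or_real[of "rel_entropy c ?b"]) (auto dest: bwd)
    with 1 show ?thesis by simp
  next
    case (2 h)
    with fwd[OF 2] show ?thesis by (simp add: E_def)
  qed
  then show ?thesis
    by (simp add: K' xy L_def M_def)
qed

end
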